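(* Let $d>s\geq 3$ be integers and let $\mathsf{h}=\max(\mathcal{G}_{d-1}^s)$. If $\imath$ is the highest index such that $\mathsf{h}+\mathsf{e}_\imath$ is an O-sequence in $\mathcal{G}_d^s$, then $\max(\mathcal{G}_d^s)=\mathsf{h}+\mathsf{e}_\imath$ and $g(\max(\mathcal{G}_d^s))=g(\max(\mathcal{G}_{d-1}^s))+\imath-1$.
   Context: Binomial expansion: for positive integers $a,t$ write uniquely $a=\binom{k(t)}{t}+\binom{k(t-1)}{t-1}+\cdots+\binom{k(j)}{j}$ with $k(t)>k(t-1)>\cdots>k(j)\geq j\geq 1$, and set $a^{\langle t\rangle}:=\binom{k(t)+1}{t+1}+\binom{k(t-1)+1}{t}+\cdots+\binom{k(j)+1}{j+1}$; also $0^{\langle t\rangle}:=0$. A function $\mathsf{h}:\mathbb{N}\to\mathbb{N}$ is an O-sequence if $\mathsf{h}(0)=1$ and $\mathsf{h}(t+1)\leq \mathsf{h}(t)^{\langle t\rangle}$ for every $t\geq 1$. It is finite if $\mathsf{h}(t)=0$ for some $t$ (and then for all larger arguments); a finite O-sequence is written $(h_0,\ldots,h_{s-1})$ with $h_{s-1}\neq 0$, $s$ is its length, and $e(\mathsf{h})=\sum_{i=0}^{s-1}h_i$ is its multiplicity. The sequence $\mathsf{e}_i$ is $1$ at index $i$ (indices starting from $0$) and $0$ elsewhere. $\mathcal{G}_d^s$ is the set of finite O-sequences of multiplicity $d$ and length $s$. The genus of a finite O-sequence $\mathsf{h}=(h_0,\ldots,h_{s-1})$ is $g(\mathsf{h}):=\sum_{j=2}^{s-1}(j-1)h_j$.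 The maximum $\max(\mathcal{G}_d^s)$ is taken with respect to the following total order $<$ on $\mathcal{G}_d^s$: for distinct $\mathsf{h}=(1,h_1,\ldots,h_{s-1})$ and $\mathsf{h}'=(1,h_1',\ldots,h_{s-1}')$, $\mathsf{h}<\mathsf{h}'$ if $h_\ell<h'_\ell$, where $\ell:=\max\{j: h_j\neq h_j'\}$. *)

theory Defs
  imports Complex_Main "HOL-Library.Function_Algebras"
begin

text \<open>The \<open>t\<close>-binomial expansion \<open>a = (k(t) choose t) + \<dots> + (k(j) choose j)\<close> with
  \<open>k(t) > \<dots> > k(j) \<ge> j \<ge> 1\<close>. Only the values of \<open>k\<close> on \<open>{j..t}\<close> matter.\<close>

definition binomial_expansion :: "nat \<Rightarrow> nat \<Rightarrow> nat \<Rightarrow> (nat \<Rightarrow> nat) \<Rightarrow> bool" where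
  "binomial_expansion a t j k \<longleftrightarrow>
     1 \<le> j \<and> j \<le> t \<and> j \<le> k j \<and> strict_mono_on {j..t} k \<and> a = (\<Sum>i=j..t. k i choose i)"

text \<open>The operation written \<open>a\<close> to the \<open>\<langle>t\<rangle>\<close>. For \<open>a, t \<ge> 1\<close> the expansion exists and is unique,
  so the description below denotes the value computed from it; \<open>t = 0\<close> is never used.\<close>

definition macaulay :: "nat \<Rightarrow> nat \<Rightarrow> nat" where
  "macaulay a t =
     (if a = 0 then 0
      else (THE b. \<exists>j k. binomial_expansion a t j k \<and> b = (\<Sum>i=j..t. (k i + 1) choose (i + 1))))"

definition O_sequence :: "(nat \<Rightarrow> nat) \<Rightarrow> bool" where
  "O_sequence h \<longleftrightarrow> h 0 = 1 \<and> (\<forall>t\<ge>1. h (t + 1) \<le> macaulay (h t) t)"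

definition finite_O_sequence :: "(nat \<Rightarrow> nat) \<Rightarrow> bool" where
  "finite_O_sequence h \<longleftrightarrow> O_sequence h \<and> (\<exists>t. h t = 0)"

text \<open>A finite O-sequence vanishes from its first zero onwards, so \<open>(h\<^sub>0, \<dots>, h\<^sub>s\<^sub>-\<^sub>1)\<close> with
  \<open>h\<^sub>s\<^sub>-\<^sub>1 \<noteq> 0\<close> is cut off at that zero.\<close>

definition seq_length :: "(nat \<Rightarrow> nat) \<Rightarrow> nat" where
  "seq_length h = (LEAST t. h t = 0)"

definition multiplicity :: "(nat \<Rightarrow> nat) \<Rightarrow> nat" where
  "multiplicity h = (\<Sum>i<seq_length h. h i)"

definition genus :: "(nat \<Rightarrow> nat) \<Rightarrow> nat" where
  "genus h = (\<Sum>j=2..<seq_length h. (j - 1) * h j)"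

definition O_seqs :: "nat \<Rightarrow> nat \<Rightarrow> (nat \<Rightarrow> nat) set" where
  "O_seqs d s = {h. finite_O_sequence h \<and> multiplicity h = d \<and> seq_length h = s}"

definition seq_less :: "(nat \<Rightarrow> nat) \<Rightarrow> (nat \<Rightarrow> nat) \<Rightarrow> bool" where
  "seq_less h h' \<longleftrightarrow> h \<noteq> h' \<and> (let l = Max {j. h j \<noteq> h' j} in h l < h' l)"

definition is_max_O_seq :: "nat \<Rightarrow> nat \<Rightarrow> (nat \<Rightarrow> nat) \<Rightarrow> bool" where
  "is_max_O_seq d s h \<longleftrightarrow> h \<in> O_seqs d s \<and> (\<forall>h' \<in> O_seqs d s. h' \<noteq> h \<longrightarrow> seq_less h' h)"

definition max_O_seq :: "nat \<Rightarrow> nat \<Rightarrow> (nat \<Rightarrow> nat)" where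
  "max_O_seq d s = (THE h. is_max_O_seq d s h)"

definition unit_seq :: "nat \<Rightarrow> nat \<Rightarrow> nat" where
  "unit_seq i j = (if j = i then 1 else 0)"

lemma O_sequence_zero_Suc:
  assumes "O_sequence h" "h t = 0"
  shows "h (Suc t) = 0"
proof -
  have "t \<noteq> 0"
    using assms unfolding O_sequence_def by (cases "t = 0") simp_all
  then have "h (t + 1) \<le> macaulay (h t) t"
    using assms(1) unfolding O_sequence_def by simp
  then show ?thesis
    using assms(2) by (simp add: macaulay_def)
qed

lemma O_sequence_zero_above:
  assumes "O_sequence h" "h t = 0" "t \<le> u"
  shows "h u = 0"
  using assms(3)
proof (induction u rule: dec_induct)
  case base
  show ?case by (rule assms(2))
next
  case (step n)
  then show ?case using O_sequence_zero_Suc[OF assms(1)] by simp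
qed

lemma O_seqs_zero:
  assumes "h \<in> O_seqs d s" "s \<le> u"
  shows "h u = 0"
proof -
  have h: "O_sequence h" "\<exists>t. h t = 0" and s: "s = (LEAST t. h t = 0)"
    using assms(1) by (simp_all add: O_seqs_def finite_O_sequence_def seq_length_def)
  from h(2) have "h s = 0"
    unfolding s by (rule LeastI_ex)
  from O_sequence_zero_above[OF h(1) this assms(2)] show ?thesis .
qed

lemma finite_O_seqs: "finite (O_seqs d s)"
proof (rule finite_subset)
  show "O_seqs d s \<subseteq> {h. \<forall>i. (i \<in> {..<s} \<longrightarrow> h i \<in> {..d}) \<and> (i \<notin> {..<s} \<longrightarrow> h i = 0)}"
  proof (intro subsetI CollectI allI conjI impI)
    fix h i assume h: "h \<in> O_seqs d s"
    show "h i = 0" if "i \<notin> {..<s}"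
      using O_seqs_zero[OF h] that by auto
    show "h i \<in> {..d}" if "i \<in> {..<s}"
    proof -
      have "h i \<le> (\<Sum>i<s. h i)"
        using that by (intro member_le_sum) auto
      then show ?thesis
        using h by (auto simp: O_seqs_def multiplicity_def)
    qed
  qed
next
  show "finite {h. \<forall>i. (i \<in> {..<s} \<longrightarrow> h i \<in> {..d}) \<and> (i \<notin> {..<s} \<longrightarrow> h i = (0::nat))}"
    by (rule finite_set_of_finite_funs) simp_all
qed

lemma seq_less_iff:
  assumes "h \<in> O_seqs d s" "h' \<in> O_seqs d' s'"
  shows "seq_less h h' \<longleftrightarrow> (\<exists>l. h l < h' l \<and> (\<forall>j>l. h j = h' j))"
proof -
  let ?D = "{j. h j \<noteq> h' j}"
  have "?D \<subseteq> {..<max s s'}"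
  proof
    fix j assume "j \<in> ?D"
    then show "j \<in> {..<max s s'}"
      using O_seqs_zero[OF assms(1), of j] O_seqs_zero[OF assms(2), of j] by (cases "j < max s s'") auto
  qed
  then have fin: "finite ?D"
    by (rule finite_subset) simp
  show ?thesis
  proof
    assume "seq_less h h'"
    then have "h (Max ?D) < h' (Max ?D)"
      unfolding seq_less_def Let_def by blast
    moreover have "h j = h' j" if "j > Max ?D" for j
    proof (rule ccontr)
      assume "h j \<noteq> h' j"
      then have "j \<le> Max ?D" by (intro Max_ge fin) simp
      with that show False by simp
    qed
    ultimately show "\<exists>l. h l < h' l \<and> (\<forall>j>l. h j = h' j)" by blast
  next
    assume "\<exists>l. h l < h' l \<and> (\<forall>j>l. h j = h' j)"
    then obtain l where l: "h l < h' l" "\<forall>j>l. h j = h' j" by blast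
    then have "Max ?D = l"
    proof (intro Max_eqI fin)
      show "l \<in> ?D" using l(1) by simp
      show "j \<le> l" if "j \<in> ?D" for j
        using l(2) that by (cases "l < j") auto
    qed
    with l show "seq_less h h'"
      unfolding seq_less_def Let_def by (metis less_irrefl)
  qed
qed

lemma seq_less_trans:
  assumes "h \<in> O_seqs d s" "h' \<in> O_seqs d s" "h'' \<in> O_seqs d s"
    and "seq_less h h'" "seq_less h' h''"
  shows "seq_less h h''"
proof -
  obtain l m where l: "h l < h' l" "\<forall>j>l. h j = h' j" and m: "h' m < h'' m" "\<forall>j>m. h' j = h'' j"
    using assms(4,5) seq_less_iff[OF assms(1,2)] seq_less_iff[OF assms(2,3)] by blast
  have "h (max l m) < h'' (max l m)"
    using l m by (cases l m rule: linorder_cases) auto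
  moreover have "\<forall>j>max l m. h j = h'' j"
    using l(2) m(2) by simp
  ultimately show ?thesis
    using seq_less_iff[OF assms(1,3)] by blast
qed

lemma seq_less_asym: "seq_less h h' \<Longrightarrow> \<not> seq_less h' h"
proof -
  have "{j. h' j \<noteq> h j} = {j. h j \<noteq> h' j}" by auto
  then show "seq_less h h' \<Longrightarrow> \<not> seq_less h' h"
    unfolding seq_less_def Let_def by simp
qed

lemma seq_less_total:
  assumes "h \<in> O_seqs d s" "h' \<in> O_seqs d s" "h \<noteq> h'"
  shows "seq_less h h' \<or> seq_less h' h"
proof -
  let ?D = "{j. h j \<noteq> h' j}"
  have "?D \<subseteq> {..<s}"
  proof
    fix j assume "j \<in> ?D"
    then show "j \<in> {..<s}"
      using O_seqs_zero[OF assms(1), of j] O_seqs_zero[OF assms(2), of j] by (cases "j < s") auto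
  qed
  then have "finite ?D"
    by (rule finite_subset) simp
  then have "Max ?D \<in> ?D"
    using assms(3) by (intro Max_in) auto
  moreover have "{j. h' j \<noteq> h j} = ?D" by auto
  ultimately show ?thesis
    using assms(3) unfolding seq_less_def Let_def by auto
qed

text \<open>Hence \<open>max_O_seq d s\<close> is the maximum of \<open>O_seqs d s\<close> whenever this set is nonempty.\<close>

lemma is_max_O_seq_unique:
  assumes "is_max_O_seq d s h" "is_max_O_seq d s h'"
  shows "h = h'"
proof (rule ccontr)
  assume "h \<noteq> h'"
  then have "seq_less h h'" "seq_less h' h"
    using assms unfolding is_max_O_seq_def by simp_all
  then show False
    using seq_less_asym by simp
qed

lemma is_max_max_O_seq:
  assumes "O_seqs d s \<noteq> {}"
  shows "is_max_O_seq d s (max_O_seq d s)"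
proof -
  have "\<exists>m\<in>A. \<forall>h'\<in>A. h' \<noteq> m \<longrightarrow> seq_less h' m"
    if "finite A" "A \<noteq> {}" "A \<subseteq> O_seqs d s" for A
    using that
  proof (induction A rule: finite_ne_induct)
    case (singleton x)
    then show ?case by auto
  next
    case (insert x F)
    then obtain m where m: "m \<in> F" "\<forall>h'\<in>F. h' \<noteq> m \<longrightarrow> seq_less h' m" by auto
    have mem: "x \<in> O_seqs d s" "m \<in> O_seqs d s" "x \<noteq> m"
      using insert.hyps insert.prems m(1) by auto
    show ?case
    proof (cases "seq_less x m")
      case True
      show ?thesis
        by (rule bexI[of _ m]) (use True m in auto)
    next
      case False
      then have mx: "seq_less m x"
        using seq_less_total[OF mem] by simp
      have "seq_less y x" if "y \<in> F" for y
      proof (cases "y = m")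
        case True
        then show ?thesis using mx by simp
      next
        case False
        have "y \<in> O_seqs d s" "seq_less y m"
          using that False insert.prems m(2) by auto
        then show ?thesis
          using seq_less_trans[OF _ mem(2,1) _ mx] by simp
      qed
      then show ?thesis
        by (intro bexI[of _ x]) auto
    qed
  qed
  then have "\<exists>m\<in>O_seqs d s. \<forall>h'\<in>O_seqs d s. h' \<noteq> m \<longrightarrow> seq_less h' m"
    using assms finite_O_seqs by simp
  then obtain m where m: "is_max_O_seq d s m"
    unfolding is_max_O_seq_def by auto
  show ?thesis
    unfolding max_O_seq_def by (rule theI[where P = "is_max_O_seq d s" and a = m, OF m]) (rule is_max_O_seq_unique[OF _ m])
qed

end

theory Submission
  imports Defs
begin

text \<open>Write \<open>f = h + e\<^sub>\<iota>\<close> and suppose some \<open>H\<close> of multiplicity \<open>d\<close> and length \<open>s\<close> exceeds \<open>f\<close>.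
  Since no \<open>h + e\<^sub>j\<close> with \<open>j > \<iota>\<close> is admissible, \<open>h\<close> grows maximally at all steps above \<open>\<iota>\<close>, and
  monotonicity of the Macaulay operation forces \<open>H \<ge> f\<close> at all indices from \<open>\<iota>\<close> on. The
  multiplicities agree, so there is a last index \<open>m < \<iota>\<close> with \<open>H m < f m\<close>. Comparison with \<open>H\<close> at
  \<open>m\<close> and \<open>m + 1\<close> shows that \<open>f\<close> may be lowered by one at \<open>m\<close>; the resulting O-sequence has
  multiplicity \<open>d - 1\<close> and exceeds \<open>h\<close>, contradicting the maximality of \<open>h\<close>.\<close>

section \<open>The Macaulay operation\<close>

lemma binomial_expansion_self_iff:
  "binomial_expansion a t t k \<longleftrightarrow> 1 \<le> t \<and> t \<le> k t \<and> a = k t choose t"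
  by (auto simp: binomial_expansion_def strict_mono_on_def)

text \<open>Peeling off the top term leaves an expansion of the remainder with the same
  \<open>k\<close> and \<open>j\<close>; this drives the inductions on \<open>t\<close>.\<close>

lemma binomial_expansion_Suc_iff:
  assumes "j \<le> t"
  shows "binomial_expansion a (Suc t) j k \<longleftrightarrow>
    (\<exists>a'. a = a' + (k (Suc t) choose Suc t) \<and> k t < k (Suc t) \<and> binomial_expansion a' t j k)"
proof -
  have "strict_mono_on {j..Suc t} k \<longleftrightarrow> k t < k (Suc t) \<and> strict_mono_on {j..t} k"
  proof (intro iffI conjI)
    assume *: "strict_mono_on {j..Suc t} k"
    show "k t < k (Suc t)"
      using * assms by (auto intro: strict_mono_onD)
    show "strict_mono_on {j..t} k"
      using * by (simp add: strict_mono_on_def)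
  next
    assume *: "k t < k (Suc t) \<and> strict_mono_on {j..t} k"
    show "strict_mono_on {j..Suc t} k"
    proof (rule strict_mono_onI)
      fix r u assume ru: "r \<in> {j..Suc t}" "u \<in> {j..Suc t}" "r < u"
      show "k r < k u"
      proof (cases "u = Suc t")
        case True
        have "k r \<le> k t"
          using * ru by (cases "r = t") (auto intro!: less_imp_le strict_mono_onD[of "{j..t}" k])
        with * True show ?thesis by simp
      next
        case False
        with * ru show ?thesis by (auto intro: strict_mono_onD)
      qed
    qed
  qed
  with assms show ?thesis
    by (auto simp: binomial_expansion_def add.commute)
qed

lemma binomial_expansion_pos: "binomial_expansion a t j k \<Longrightarrow> 0 < a"
proof -
  assume *: "binomial_expansion a t j k"
  then have "0 < k j choose j"
    by (simp add: binomial_expansion_def)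
  moreover have "k j choose j \<le> a"
    using * unfolding binomial_expansion_def by (auto intro!: member_le_sum[of j])
  ultimately show ?thesis by linarith
qed

lemma binomial_expansion_ge: "binomial_expansion a t j k \<Longrightarrow> k t choose t \<le> a"
  unfolding binomial_expansion_def by (auto intro!: member_le_sum[of t])

text \<open>By Pascal's rule the remainder after the top term only has to stay below
  \<open>k (Suc t) choose t\<close>; induction and strict growth of \<open>k\<close> give
  this.\<close>

lemma binomial_expansion_less: "binomial_expansion a t j k \<Longrightarrow> a < Suc (k t) choose t"
proof (induction t arbitrary: a)
  case 0
  then show ?case unfolding binomial_expansion_def by linarith
next
  case (Suc t)
  have jt: "j \<le> Suc t" using Suc.prems by (simp add: binomial_expansion_def)
  show ?case
  proof (cases "j = Suc t")
    case True
    with Suc.prems show ?thesis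
      by (simp add: binomial_expansion_self_iff)
  next
    case False
    with jt Suc.prems obtain a' where a': "a = a' + (k (Suc t) choose Suc t)" "k t < k (Suc t)"
      "binomial_expansion a' t j k"
      using binomial_expansion_Suc_iff[of j t a k] by auto
    have "a' < Suc (k t) choose t" by (rule Suc.IH[OF a'(3)])
    also have "\<dots> \<le> k (Suc t) choose t"
      using a'(2) by (intro binomial_right_mono) simp
    finally show ?thesis using a'(1) by simp
  qed
qed

text \<open>The shifted sum comes with its own expansion one degree higher, so both leading-term
  bounds apply to it as well.\<close>

lemma binomial_expansion_shift:
  assumes "binomial_expansion a t j k"
  shows "binomial_expansion (\<Sum>i=j..t. (k i + 1) choose (i + 1)) (Suc t) (Suc j) (\<lambda>i. Suc (k (i - 1)))"
proof -
  have "strict_mono_on {Suc j..Suc t} (\<lambda>i. Suc (k (i - 1)))"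
  proof (rule strict_mono_onI)
    fix r u assume "r \<in> {Suc j..Suc t}" "u \<in> {Suc j..Suc t}" "r < u"
    then have "r - 1 \<in> {j..t}" "u - 1 \<in> {j..t}" "r - 1 < u - 1" by auto
    then show "Suc (k (r - 1)) < Suc (k (u - 1))"
      using assms by (auto simp only: binomial_expansion_def Suc_less_eq intro: strict_mono_onD)
  qed
  moreover have "(\<Sum>i=j..t. (k i + 1) choose (i + 1)) = (\<Sum>i=Suc j..Suc t. Suc (k (i - 1)) choose i)"
    unfolding sum.shift_bounds_cl_Suc_ivl by simp
  ultimately show ?thesis
    using assms unfolding binomial_expansion_def by simp
qed

text \<open>Expansions compare lexicographically from the top term down, and the shift preserves
  this comparison.\<close>

lemma binomial_expansion_shift_mono:
  assumes "binomial_expansion a t j k" "binomial_expansion a' t j' k'" "a \<le> a'"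
  shows "(\<Sum>i=j..t. (k i + 1) choose (i + 1)) \<le> (\<Sum>i=j'..t. (k' i + 1) choose (i + 1))"
  using assms
proof (induction t arbitrary: a a')
  case 0
  then show ?case unfolding binomial_expansion_def by linarith
next
  case (Suc t)
  let ?k = "k (Suc t)" and ?k' = "k' (Suc t)"
  let ?B = "\<Sum>i=j..Suc t. (k i + 1) choose (i + 1)"
  let ?B' = "\<Sum>i=j'..Suc t. (k' i + 1) choose (i + 1)"
  have jt: "j \<le> Suc t" "j' \<le> Suc t"
    using Suc.prems by (simp_all add: binomial_expansion_def)
  have B': "Suc ?k' choose Suc (Suc t) \<le> ?B'"
    using binomial_expansion_ge[OF binomial_expansion_shift[OF Suc.prems(2)]] by simp
  consider (less) "?k < ?k'" | (greater) "?k' < ?k" | (equal) "?k = ?k'" by linarith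
  then show ?case
  proof cases
    case less
    \<comment> \<open>A smaller top decides: the whole shifted sum stays below the leading shifted
      term of the other.\<close>
    have "?B < Suc (Suc ?k) choose Suc (Suc t)"
      using binomial_expansion_less[OF binomial_expansion_shift[OF Suc.prems(1)]] by simp
    also have "\<dots> \<le> Suc ?k' choose Suc (Suc t)"
      using less by (intro binomial_right_mono) simp
    finally show ?thesis using B' by linarith
  next
    case greater
    \<comment> \<open>This case is impossible, as it would force \<open>a' < a\<close>.\<close>
    have "a' < Suc ?k' choose Suc t"
      by (rule binomial_expansion_less[OF Suc.prems(2)])
    also have "\<dots> \<le> ?k choose Suc t"
      using greater by (intro binomial_right_mono) simp
    also have "\<dots> \<le> a"
      by (rule binomial_expansion_ge[OF Suc.prems(1)])
    finally show ?thesis using Suc.prems(3) by simp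
  next
    case equal
    show ?thesis
    proof (cases "j = Suc t")
      case True
      then show ?thesis using equal B' by simp
    next
      case False
      then obtain c where c: "a = c + (?k choose Suc t)" "binomial_expansion c t j k"
        using jt Suc.prems(1) binomial_expansion_Suc_iff[of j t a k] by auto
      \<comment> \<open>Since \<open>a\<close> exceeds the common leading term by
        \<open>c > 0\<close>, \<open>a'\<close> cannot consist of that term alone.\<close>
      have "j' \<noteq> Suc t"
      proof
        assume "j' = Suc t"
        then have "a' = ?k choose Suc t"
          using Suc.prems(2) equal by (simp add: binomial_expansion_self_iff)
        with c binomial_expansion_pos[OF c(2)] Suc.prems(3) show False by simp
      qed
      then obtain c' where c': "a' = c' + (?k' choose Suc t)" "binomial_expansion c' t j' k'"
        using jt Suc.prems(2) binomial_expansion_Suc_iff[of j' t a' k'] by auto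
      have "(\<Sum>i=j..t. (k i + 1) choose (i + 1)) \<le> (\<Sum>i=j'..t. (k' i + 1) choose (i + 1))"
        using c c' equal Suc.prems(3) by (intro Suc.IH[of c c']) simp_all
      then show ?thesis
        using jt equal by simp
    qed
  qed
qed

text \<open>Greedy choice: take the largest binomial coefficient of the top degree that fits into
  \<open>a\<close>, then expand the remainder one degree lower.\<close>

lemma binomial_expansion_exists:
  assumes "1 \<le> a" "1 \<le> t"
  shows "\<exists>j k. binomial_expansion a t j k"
  using assms(2,1)
proof (induction t arbitrary: a rule: dec_induct)
  case base
  have "binomial_expansion a 1 1 (\<lambda>_. a)"
    using base by (simp add: binomial_expansion_self_iff)
  then show ?case by blast
next
  case (step t)
  let ?P = "\<lambda>n. n choose Suc t \<le> a"
  \<comment> \<open>\<open>GREATEST\<close> needs bounded candidates; \<open>a + t\<close> works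
    because \<open>Suc (a + t) choose Suc t\<close> exceeds \<open>a\<close>.\<close>
  have bound: "n \<le> a + t" if "?P n" for n
  proof (rule ccontr)
    assume "\<not> n \<le> a + t"
    then have "Suc (a + t) choose Suc t \<le> n choose Suc t"
      by (intro binomial_right_mono) simp
    moreover have "Suc (a + t) choose Suc t \<ge> Suc a"
    proof -
      have "Suc (a + t) choose Suc t = Suc (a + t) choose a"
        by (subst binomial_symmetric) simp_all
      moreover have "Suc a \<le> Suc (a + t) choose a"
      proof -
        have "Suc a = Suc a choose a"
          by simp
        also have "\<dots> \<le> Suc (a + t) choose a"
          by (intro binomial_right_mono) simp
        finally show ?thesis .
      qed
      ultimately show ?thesis by simp
    qed
    ultimately show False using that by simp
  qed
  have P0: "?P (Suc t)" using step.prems by simp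
  define n where "n = (GREATEST n. ?P n)"
  have n: "?P n" "Suc t \<le> n"
    unfolding n_def
    using GreatestI_nat[of ?P "Suc t" "a + t"] Greatest_le_nat[of ?P "Suc t" "a + t"] P0 bound by auto
  have "\<not> ?P (Suc n)"
    unfolding n_def using Greatest_le_nat[of ?P "Suc (GREATEST n. ?P n)" "a + t"] bound by auto
  \<comment> \<open>Maximality of \<open>n\<close> with Pascal's rule; this keeps the next top
    \<open>k t\<close> below \<open>n\<close>.\<close>
  then have less: "a - (n choose Suc t) < n choose t" using n(1) by simp
  show ?case
  proof (cases "a = n choose Suc t")
    case True
    then have "binomial_expansion a (Suc t) (Suc t) (\<lambda>_. n)"
      using n by (simp add: binomial_expansion_self_iff)
    then show ?thesis by blast
  next
    case False
    with n have "1 \<le> a - (n choose Suc t)" by simp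
    from step.IH[OF this] obtain j k where jk: "binomial_expansion (a - (n choose Suc t)) t j k"
      by blast
    have jt: "j \<le> t" using jk by (simp add: binomial_expansion_def)
    have "k t choose t < n choose t"
      using binomial_expansion_ge[OF jk] less by simp
    then have "k t < n"
      using binomial_right_mono[of n "k t" t] by (meson not_le)
    moreover have "binomial_expansion (a - (n choose Suc t)) t j (k(Suc t := n))"
    proof -
      have "strict_mono_on {j..t} (k(Suc t := n)) = strict_mono_on {j..t} k"
        by (auto simp: strict_mono_on_def)
      with jk show ?thesis by (auto simp: binomial_expansion_def)
    qed
    ultimately have "binomial_expansion a (Suc t) j (k(Suc t := n))"
      using jt n by (subst binomial_expansion_Suc_iff) (auto intro!: exI[of _ "a - (n choose Suc t)"])
    then show ?thesis by blast
  qed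
qed

text \<open>Monotonicity applied in both directions with equal arguments shows that all expansions
  of \<open>a\<close> give the same shifted sum, so the \<open>THE\<close> denotes it.\<close>

lemma macaulay_eq:
  assumes "binomial_expansion a t j k"
  shows "macaulay a t = (\<Sum>i=j..t. (k i + 1) choose (i + 1))"
proof -
  have "(THE b. \<exists>j k. binomial_expansion a t j k \<and> b = (\<Sum>i=j..t. (k i + 1) choose (i + 1)))
      = (\<Sum>i=j..t. (k i + 1) choose (i + 1))"
  proof (rule the_equality)
    show "\<exists>j' k'. binomial_expansion a t j' k' \<and>
        (\<Sum>i=j..t. (k i + 1) choose (i + 1)) = (\<Sum>i=j'..t. (k' i + 1) choose (i + 1))"
      using assms by blast
  next
    fix b assume "\<exists>j k. binomial_expansion a t j k \<and> b = (\<Sum>i=j..t. (k i + 1) choose (i + 1))"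
    then show "b = (\<Sum>i=j..t. (k i + 1) choose (i + 1))"
      using binomial_expansion_shift_mono[OF assms] binomial_expansion_shift_mono[OF _ assms]
      by (metis le_antisym order_refl)
  qed
  then show ?thesis
    using binomial_expansion_pos[OF assms] by (simp add: macaulay_def)
qed

lemma macaulay_mono:
  assumes "a \<le> b" "1 \<le> t"
  shows "macaulay a t \<le> macaulay b t"
proof (cases "a = 0")
  case True
  then show ?thesis by (simp add: macaulay_def)
next
  case False
  then obtain j k j' k' where "binomial_expansion a t j k" "binomial_expansion b t j' k'"
    using binomial_expansion_exists[of a t] binomial_expansion_exists[of b t] assms by auto
  then show ?thesis
    using binomial_expansion_shift_mono[OF _ _ assms(1)] by (simp only: macaulay_eq)
qed

text \<open>Pascal's rule gives the inequality term by term; hence nonincreasing tails satisfy the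
  growth condition.\<close>

lemma macaulay_ge:
  assumes "1 \<le> t"
  shows "a \<le> macaulay a t"
proof (cases "a = 0")
  case False
  then obtain j k where e: "binomial_expansion a t j k"
    using binomial_expansion_exists[of a t] assms by auto
  then have "a = (\<Sum>i=j..t. k i choose i)" by (simp add: binomial_expansion_def)
  also have "\<dots> \<le> (\<Sum>i=j..t. (k i + 1) choose (i + 1))"
    by (intro sum_mono) simp
  finally show ?thesis by (simp only: macaulay_eq[OF e])
qed simp

section \<open>O-sequences of given multiplicity and length\<close>

lemma O_seqs_iff:
  "h \<in> O_seqs d s \<longleftrightarrow> O_sequence h \<and> h s = 0 \<and> (\<forall>j<s. h j \<noteq> 0) \<and> (\<Sum>j<s. h j) = d"
proof
  assume h: "h \<in> O_seqs d s"
  then have "h s = 0" by (rule O_seqs_zero) simp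
  with h show "O_sequence h \<and> h s = 0 \<and> (\<forall>j<s. h j \<noteq> 0) \<and> (\<Sum>j<s. h j) = d"
    by (auto simp: O_seqs_def finite_O_sequence_def seq_length_def multiplicity_def dest: not_less_Least)
next
  assume *: "O_sequence h \<and> h s = 0 \<and> (\<forall>j<s. h j \<noteq> 0) \<and> (\<Sum>j<s. h j) = d"
  then have "seq_length h = s"
    unfolding seq_length_def by (intro Least_equality) (auto intro: leI)
  with * show "h \<in> O_seqs d s"
    by (auto simp: O_seqs_def finite_O_sequence_def multiplicity_def)
qed

lemma O_sequence_macaulay: "O_sequence h \<Longrightarrow> 1 \<le> t \<Longrightarrow> h (Suc t) \<le> macaulay (h t) t"
  by (simp add: O_sequence_def)

text \<open>Constant weights \<open>c\<close> serve for multiplicities, the weight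
  \<open>j - 1\<close> for the genus.\<close>

lemma sum_unit_seq: "finite A \<Longrightarrow> (\<Sum>j\<in>A. c j * unit_seq i j) = (if i \<in> A then c i else 0)"
  unfolding unit_seq_def by (simp add: if_distrib[of "\<lambda>x. c _ * x"] cong: if_cong)

lemma O_seqs_nonempty:
  assumes "2 \<le> s" "s \<le> d"
  shows "O_seqs d s \<noteq> {}"
proof -
  \<comment> \<open>The witness is \<open>(1, d - s + 1, 1, ..., 1)\<close>, nonincreasing from
    index 1 on.\<close>
  define h where "h = (\<lambda>t. if t < s then if t = 1 then Suc (d - s) else 1 else 0)"
  have "h (Suc t) \<le> macaulay (h t) t" if "1 \<le> t" for t
  proof -
    have "h (Suc t) \<le> h t" using that by (auto simp: h_def)
    also have "\<dots> \<le> macaulay (h t) t" by (rule macaulay_ge[OF that])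
    finally show ?thesis .
  qed
  moreover have "h 0 = 1" using assms by (simp add: h_def)
  ultimately have "O_sequence h" by (simp add: O_sequence_def)
  moreover have "(\<Sum>j<s. h j) = d"
  proof -
    have "(\<Sum>j<s. h j) = (\<Sum>j<s. 1 + (d - s) * unit_seq 1 j)"
      by (intro sum.cong) (auto simp: h_def unit_seq_def)
    also have "\<dots> = d" using assms by (subst sum.distrib, subst sum_unit_seq) simp_all
    finally show ?thesis .
  qed
  ultimately have "h \<in> O_seqs d s" using assms by (simp add: O_seqs_iff h_def)
  then show ?thesis by blast
qed

section \<open>Raising and lowering a single entry\<close>

text \<open>The slack at \<open>t\<close> absorbs the extra unit, and by monotonicity a larger entry
  at \<open>Suc t\<close> only relaxes the next condition.\<close>

lemma O_seqs_add_unit_seq: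
  assumes h: "h \<in> O_seqs d s" and t: "1 \<le> t" "Suc t < s" and less: "h (Suc t) < macaulay (h t) t"
  shows "h + unit_seq (Suc t) \<in> O_seqs (Suc d) s"
proof -
  let ?f = "h + unit_seq (Suc t)"
  have O: "O_sequence h" using h by (simp add: O_seqs_iff)
  have "?f (Suc u) \<le> macaulay (?f u) u" if "1 \<le> u" for u
  proof (cases "u = t")
    case True
    with less show ?thesis by (simp add: unit_seq_def)
  next
    case False
    then have "?f (Suc u) = h (Suc u)" by (simp add: unit_seq_def)
    also have "\<dots> \<le> macaulay (h u) u" by (rule O_sequence_macaulay[OF O that])
    also have "\<dots> \<le> macaulay (?f u) u" by (rule macaulay_mono[OF _ that]) simp
    finally show ?thesis .
  qed
  then have "O_sequence ?f" using O by (simp add: O_sequence_def unit_seq_def)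
  moreover have "(\<Sum>j<s. ?f j) = Suc d"
    using h t sum_unit_seq[of "{..<s}" "\<lambda>_. 1" "Suc t"] by (simp add: O_seqs_iff sum.distrib)
  ultimately show ?thesis using h t by (simp add: O_seqs_iff unit_seq_def)
qed

text \<open>Only the growth condition from \<open>m\<close> to \<open>Suc m\<close> is endangered,
  and \<open>H\<close> vouches for it:
  \<open>f (Suc m) \<le> H (Suc m) \<le> macaulay (H m) m\<close> with
  \<open>H m \<le> f m - 1\<close>.\<close>

lemma O_seqs_decrement:
  assumes f: "f \<in> O_seqs d s" and H: "H \<in> O_seqs d' s"
    and m: "H m < f m" "f (Suc m) \<le> H (Suc m)"
  shows "f(m := f m - 1) \<in> O_seqs (d - 1) s"
proof -
  let ?g = "f(m := f m - 1)"
  have O: "O_sequence f" "O_sequence H" using f H by (simp_all add: O_seqs_iff)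
  then have "f 0 = 1" "H 0 = 1" by (simp_all add: O_sequence_def)
  with m(1) have m0: "1 \<le> m" by (cases m) simp_all
  have ms: "m < s"
    using m(1) O_seqs_zero[OF f, of m] by (cases "m < s") simp_all
  \<comment> \<open>From \<open>0 < H m \<le> f m - 1\<close> the lowered entry stays nonzero, so
    the length remains \<open>s\<close>.\<close>
  have Hm: "H m \<noteq> 0" using H ms by (simp add: O_seqs_iff)
  have "?g (Suc u) \<le> macaulay (?g u) u" if "1 \<le> u" for u
  proof (cases "u = m")
    case True
    have "f (Suc m) \<le> macaulay (H m) m"
      using m(2) O_sequence_macaulay[OF O(2) m0] by simp
    also have "\<dots> \<le> macaulay (f m - 1) m"
      using m(1) by (intro macaulay_mono m0) simp
    finally show ?thesis using True by simp
  next
    case False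
    then show ?thesis using O_sequence_macaulay[OF O(1) that] by auto
  qed
  then have "O_sequence ?g" using m0 \<open>f 0 = 1\<close> by (simp add: O_sequence_def)
  moreover have "(\<Sum>j<s. ?g j) = d - 1"
  proof -
    have "(\<Sum>j<s. f j) = f m + (\<Sum>j\<in>{..<s} - {m}. f j)"
      using ms by (intro sum.remove) simp_all
    moreover have "(\<Sum>j<s. ?g j) = ?g m + (\<Sum>j\<in>{..<s} - {m}. ?g j)"
      using ms by (intro sum.remove) simp_all
    moreover have "(\<Sum>j\<in>{..<s} - {m}. ?g j) = (\<Sum>j\<in>{..<s} - {m}. f j)"
      by (intro sum.cong) simp_all
    ultimately show ?thesis using f m(1) by (simp add: O_seqs_iff)
  qed
  ultimately show ?thesis using f m Hm ms by (simp add: O_seqs_iff)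
qed

section \<open>The step from multiplicity \<open>d - 1\<close> to \<open>d\<close>\<close>

theorem proposition3p4:
  fixes d s i :: nat and h :: "nat \<Rightarrow> nat"
  assumes "s \<ge> 3" and "d > s"
    and "h = max_O_seq (d - 1) s"
    and "h + unit_seq i \<in> O_seqs d s"
    and "\<And>j. h + unit_seq j \<in> O_seqs d s \<Longrightarrow> j \<le> i"
  shows "max_O_seq d s = h + unit_seq i
    \<and> int (genus (max_O_seq d s)) = int (genus (max_O_seq (d - 1) s)) + int i - 1"
proof -
  have "O_seqs (d - 1) s \<noteq> {}"
    using assms(1,2) by (intro O_seqs_nonempty) simp_all
  from is_max_max_O_seq[OF this] have hmax: "is_max_O_seq (d - 1) s h"
    by (simp add: assms(3))
  then have h: "h \<in> O_seqs (d - 1) s" by (simp add: is_max_O_seq_def)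
  define f where "f = h + unit_seq i"
  have f: "f \<in> O_seqs d s" using assms(4) by (simp add: f_def)
  have fi: "f i = Suc (h i)"
    by (simp add: f_def unit_seq_def)
  have fj: "f j = h j" if "j \<noteq> i" for j
    using that by (simp add: f_def unit_seq_def)
  \<comment> \<open>Entry 0 is 1 in both sequences, so the unit cannot sit there.\<close>
  have i1: "1 \<le> i"
    using f h fi by (cases i) (auto simp: O_seqs_iff O_sequence_def)
  have i_less: "i < s"
    using O_seqs_zero[OF f, of i] fi by (cases "i < s") simp_all
  \<comment> \<open>Any slack here would allow a unit at \<open>Suc t > i\<close>, against the
    choice of \<open>i\<close>.\<close>
  have top: "macaulay (h t) t \<le> h (Suc t)" if "i \<le> t" "Suc t < s" for t
  proof (rule ccontr)
    assume "\<not> ?thesis"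
    then have "h + unit_seq (Suc t) \<in> O_seqs (Suc (d - 1)) s"
      using that i1 by (intro O_seqs_add_unit_seq[OF h]) simp_all
    with assms(2,5) that show False by fastforce
  qed
  have "is_max_O_seq d s f"
    unfolding is_max_O_seq_def
  proof (intro conjI ballI impI f)
    fix H assume H: "H \<in> O_seqs d s" "H \<noteq> f"
    show "seq_less H f"
    proof (rule ccontr)
      assume "\<not> seq_less H f"
      then have "seq_less f H" using seq_less_total[OF H(1) f H(2)] by simp
      then obtain l where l: "f l < H l" "\<And>j. j > l \<Longrightarrow> f j = H j"
        using seq_less_iff[OF f H(1)] by blast
      have ls: "l < s"
        using l(1) O_seqs_zero[OF H(1), of l] by (cases "l < s") simp_all
      \<comment> \<open>Downward induction from \<open>l\<close>: if \<open>H j \<le> h j\<close>,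
        then maximal growth of \<open>h\<close> would give
        \<open>H (Suc j) \<le> h (Suc j)\<close>.\<close>
      have above_l: "h j < H j" if "i \<le> j" "j \<le> l" for j
        using that(2,1)
      proof (induction j rule: inc_induct)
        case base
        show ?case using l(1) fi fj[of l] by (cases "l = i") simp_all
      next
        case (step j)
        have "macaulay (h j) j \<le> h (Suc j)" using step ls by (intro top) simp_all
        also have "\<dots> < H (Suc j)" using step by simp
        also have "\<dots> \<le> macaulay (H j) j"
          using H(1) i1 step.prems by (intro O_sequence_macaulay) (simp_all add: O_seqs_iff)
        finally have "\<not> macaulay (H j) j \<le> macaulay (h j) j" by simp
        then show ?case
          using macaulay_mono[of "H j" "h j" j] i1 step.prems by linarith
      qed
      \<comment> \<open>The strict inequality just proved absorbs the unit added at
        \<open>i\<close>.\<close>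
      have above_i: "f j \<le> H j" if "i \<le> j" for j
      proof (cases "j \<le> l")
        case True
        with above_l[OF that] show ?thesis
          using fi fj[of j] by (cases "j = i") simp_all
      qed (simp add: l(2))
      let ?P = "\<lambda>m. H m < f m"
      \<comment> \<open>Equal multiplicities: the excess of \<open>H\<close> at \<open>l\<close>
        must be compensated at some index.\<close>
      have "\<exists>m. ?P m"
      proof (rule ccontr)
        assume "\<not> ?thesis"
        then have "\<And>m. f m \<le> H m" by (simp add: not_less)
        then have "(\<Sum>j<s. f j) < (\<Sum>j<s. H j)"
          using l(1) ls by (intro sum_strict_mono_ex1) auto
        with f H(1) show False by (simp add: O_seqs_iff)
      qed
      then obtain m0 where m0: "?P m0" by blast
      have bound: "\<And>j. ?P j \<Longrightarrow> j \<le> i" using above_i by (meson le_cases not_le)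
      define m where "m = (GREATEST m. ?P m)"
      have Pm: "?P m"
        unfolding m_def using m0 bound by (rule GreatestI_nat)
      have "\<not> ?P (Suc m)"
        unfolding m_def using Greatest_le_nat[of ?P "Suc (GREATEST m. ?P m)" i] bound by auto
      moreover have mi: "m < i" using Pm above_i[of m] by (meson not_le)
      ultimately have g: "f(m := f m - 1) \<in> O_seqs (d - 1) s"
        using Pm by (intro O_seqs_decrement[OF f H(1)]) simp_all
      \<comment> \<open>As \<open>m < i\<close>, the lowered sequence still has
        \<open>h i + 1\<close> at \<open>i\<close> and agrees with \<open>h\<close> above
        \<open>i\<close>.\<close>
      have "seq_less h (f(m := f m - 1))"
        unfolding seq_less_iff[OF h g] using mi fi fj by (intro exI[of _ i]) auto
      moreover have "f(m := f m - 1) \<noteq> h" using mi fi by (auto simp: fun_eq_iff)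
      then have "seq_less (f(m := f m - 1)) h"
        using hmax g by (simp add: is_max_O_seq_def)
      ultimately show False using seq_less_asym by blast
    qed
  qed
  then have max: "max_O_seq d s = f"
    using is_max_O_seq_unique is_max_max_O_seq f by blast
  have "genus f = (\<Sum>j=2..<s. (j - 1) * h j + (j - 1) * unit_seq i j)"
    using f by (simp add: genus_def O_seqs_def f_def distrib_left)
  \<comment> \<open>For \<open>i = 1\<close> the unit lies outside the range of summation and
    \<open>i - 1\<close> is 0, so the formula holds there too.\<close>
  also have "\<dots> = genus h + (i - 1)"
    using h i1 i_less sum_unit_seq[of "{2..<s}" "\<lambda>j. j - 1" i]
    by (auto simp: genus_def O_seqs_def sum.distrib)
  finally show ?thesis
    using i1 max assms(3) by (simp add: f_def)
qed

end
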